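(* Let $(q_i,y_i^w,y_i^l)$, $i=1,\dots,N$, be preference pairs with labels $c_i\in\{0,1\}$, let $p=\Pr[c_i=1]$ be the share of pairs with $c_i=1$, and put $w=p/(1-p)$. Let $$\Delta_i=\log\frac{\pi_\theta(y_i^w\mid q_i)}{\pi_\theta(y_i^l\mid q_i)}-\log\frac{\pi_{\mathrm{ref}}(y_i^w\mid q_i)}{\pi_{\mathrm{ref}}(y_i^l\mid q_i)}$$ be the margin of pair $i$, and consider the loss whose contribution from pair $i$ is $$\mathcal L_{\mathrm{SD}}=c_i\big[-\log\sigma(\beta\Delta_i)\big]+(1-c_i)\,w\,\big[-\log\sigma(-\beta\Delta_i)\big].$$ Assume the additive decomposition of the margin, that is, the approximation $$\Delta_i\approx\Delta_i^{(\mathrm F)}+\Delta^{(\mathrm S)},$$ in which the margin is approximately the sum of a factual component $\Delta_i^{(\mathrm F)}$ and a style component $\Delta^{(\mathrm S)}$, and assume (Assumption A2) that the style component is shared across pairs, i.e. does not depend on $i$. Then, under this approximation (with $\Delta_i^{(\mathrm F)}+\Delta^{(\mathrm S)}$ substituted for $\Delta_i$ in the gradient), the expected gradient of the loss over the $N$ pairs at initialization $\theta=\theta_{\mathrm{ref}}$ is proportional to $$-\Big[\sum_{i:c_i=1}\nabla_\theta\Delta_i^{(\mathrm F)}-w\sum_{i:c_i=0}\nabla_\theta\Delta_i^{(\mathrm F)}\Big]:$$ the style terms sum to $Np-w\,N(1-p)=0$ (this is the total coefficient of $\nabla_\theta\Delta^{(\mathrm S)}$) and vanish for any $p\in(0,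1)$.
   Context: A policy $\pi_\theta(\cdot\mid q)$ is a probability distribution over responses to a question $q$, depending on a parameter vector $\theta$; $\pi_{\mathrm{ref}}$ is a fixed reference policy, and training starts at $\theta_{\mathrm{ref}}$ with $\pi_{\theta_{\mathrm{ref}}}=\pi_{\mathrm{ref}}$ ("initialization"), so that every margin is $0$ there. For pair $i$, $y_i^w$ is the chosen and $y_i^l$ the rejected response to question $q_i$. The function $\sigma(t)=1/(1+e^{-t})$ is the sigmoid and $\beta>0$ is a constant controlling how far the policy may move from the reference. The labels are $c_i=1$ if $f_i<0.5$ and $c_i=0$ otherwise, where $f_i\in[0,1]$ is a given factual-agreement score of pair $i$, assigned by a judge model and not depending on $\theta$. The factual component $\Delta_i^{(\mathrm F)}$ is the part of the margin due to the factual difference between chosen and rejected response; the style component $\Delta^{(\mathrm S)}$ is the part due to their difference in style. The decomposition is an approximation whose error is not quantified; the stated gradient is obtained by substituting $\Delta_i^{(\mathrm F)}+\Delta^{(\mathrm S)}$ for $\Delta_i$. The expected gradient is the gradient averaged over the whole dataset of $N$ pairs. *)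

theory Defs
  imports "HOL-Probability.Probability"
begin

definition sigmoid :: "real \<Rightarrow> real" where
  "sigmoid t = 1 / (1 + exp (- t))"

text \<open>The gradient vector as a function of the point; meaningful only where the
  argument is differentiable.\<close>

definition grad :: "('p::euclidean_space \<Rightarrow> real) \<Rightarrow> 'p \<Rightarrow> 'p" where
  "grad f x = (THE D. GDERIV f x :> D)"

definition margin ::
  "('p \<Rightarrow> 'q \<Rightarrow> 'y pmf) \<Rightarrow> ('q \<Rightarrow> 'y pmf) \<Rightarrow> 'q \<Rightarrow> 'y \<Rightarrow> 'y \<Rightarrow> 'p \<Rightarrow> real" where
  "margin \<pi> \<pi>ref q yw yl \<theta> =
     ln (pmf (\<pi> \<theta> q) yw / pmf (\<pi> \<theta> q) yl) - ln (pmf (\<pi>ref q) yw / pmf (\<pi>ref q) yl)"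

text \<open>The loss of a single pair as a function of the value \<open>t\<close> of its margin.\<close>

definition pair_loss :: "real \<Rightarrow> real \<Rightarrow> real \<Rightarrow> real \<Rightarrow> real" where
  "pair_loss \<beta> w c t =
     c * (- ln (sigmoid (\<beta> * t))) + (1 - c) * w * (- ln (sigmoid (- \<beta> * t)))"

definition expected_grad ::
  "real \<Rightarrow> real \<Rightarrow> nat \<Rightarrow> (nat \<Rightarrow> real) \<Rightarrow> (nat \<Rightarrow> 'p::euclidean_space \<Rightarrow> real) \<Rightarrow> 'p \<Rightarrow> 'p" where
  "expected_grad \<beta> w N c \<Delta> \<theta> =
     (1 / real N) *\<^sub>R (\<Sum>i=1..N. grad (\<lambda>\<theta>'. pair_loss \<beta> w (c i) (\<Delta> i \<theta>')) \<theta>)"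

text \<open>The chain-rule form of the expected gradient at margins \<open>\<Delta>\<close>, in which the margin
  gradients are taken of \<open>D\<close>. For \<open>D = \<Delta>\<close> it is the expected gradient itself; substituting
  an approximate decomposition of the margin means choosing that decomposition as \<open>D\<close>.
  The scalar factors are evaluated at the margins \<open>\<Delta>\<close> themselves, whose values at
  initialization are known exactly.\<close>

definition chain_grad ::
  "real \<Rightarrow> real \<Rightarrow> nat \<Rightarrow> (nat \<Rightarrow> real) \<Rightarrow> (nat \<Rightarrow> 'p::euclidean_space \<Rightarrow> real) \<Rightarrow>
     (nat \<Rightarrow> 'p \<Rightarrow> real) \<Rightarrow> 'p \<Rightarrow> 'p" where
  "chain_grad \<beta> w N c \<Delta> D \<theta> =
     (1 / real N) *\<^sub>R (\<Sum>i=1..N. deriv (pair_loss \<beta> w (c i)) (\<Delta> i \<theta>) *\<^sub>R grad (D i) \<theta>)"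

end

theory Submission
  imports Defs
begin

text \<open>At initialization every margin is 0, so the derivative of the loss of a pair with respect
  to its margin is \<open>- \<beta> / 2\<close> for the pairs with label 1 and \<open>w * \<beta> / 2\<close> for those with label 0.
  There are \<open>N p\<close> pairs of the first kind and \<open>N (1 - p)\<close> of the second, and \<open>w\<close> is
  chosen so that a gradient shared by all pairs cancels.\<close>

text \<open>The derivative at a point is unique, and a vector is determined by its inner products,
  so the definite description in \<open>grad\<close> picks out any gradient that has been
  exhibited.\<close>

lemma grad_eqI:
  assumes "GDERIV f x :> D"
  shows "grad f x = D"
  unfolding grad_def
proof (rule the_equality)
  fix E assume "GDERIV f x :> E"
  then have "(\<lambda>h. inner h E) = (\<lambda>h. inner h D)"
    using assms unfolding gderiv_def by (rule has_derivative_unique)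
  then show "E = D"
    by (metis vector_eq_ldot)
qed (fact assms)

text \<open>Riesz representation in finite dimension: a linear functional is the inner product with
  the vector whose coordinates are its values on the basis.\<close>

lemma GDERIV_grad:
  assumes "f differentiable (at x)"
  shows "GDERIV f x :> grad f x"
proof -
  obtain f' where f': "(f has_derivative f') (at x)"
    using assms unfolding differentiable_def by blast
  interpret bounded_linear f'
    using f' by (rule has_derivative_bounded_linear)
  have eq: "f' h = inner h (\<Sum>b\<in>Basis. f' b *\<^sub>R b)" for h
  proof -
    have "f' h = f' (\<Sum>b\<in>Basis. inner h b *\<^sub>R b)"
      by (simp add: euclidean_representation)
    also have "\<dots> = (\<Sum>b\<in>Basis. inner h b * f' b)"
      by (simp add: sum scaleR)
    also have "\<dots> = inner h (\<Sum>b\<in>Basis. f' b *\<^sub>R b)"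
      by (simp add: inner_sum_right mult.commute)
    finally show ?thesis .
  qed
  have "GDERIV f x :> (\<Sum>b\<in>Basis. f' b *\<^sub>R b)"
    unfolding gderiv_def eq[symmetric] by (rule f')
  then show ?thesis
    by (simp add: grad_eqI)
qed

lemma grad_add:
  assumes "f differentiable (at x)" and "g differentiable (at x)"
  shows "grad (\<lambda>x. f x + g x) x = grad f x + grad g x"
  using assms by (intro grad_eqI GDERIV_add GDERIV_grad)

text \<open>The logarithmic derivative of the sigmoid is \<open>1 - sigmoid t\<close>, which by
  symmetry is \<open>sigmoid (- t)\<close>.\<close>

lemma DERIV_ln_sigmoid: "((\<lambda>t. ln (sigmoid t)) has_real_derivative sigmoid (- t)) (at t)"
proof -
  have pos: "1 + exp s > 0" and nz: "1 + exp s \<noteq> 0" for s :: real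
    using exp_gt_zero[of s] by linarith+
  \<comment> \<open>In this form no quotient has to be differentiated under the logarithm.\<close>
  have eq: "(\<lambda>t. ln (sigmoid t)) = (\<lambda>t. - ln (1 + exp (- t)))"
    by (simp add: sigmoid_def ln_div nz)
  have "((\<lambda>t. - ln (1 + exp (- t))) has_real_derivative exp (- t) / (1 + exp (- t))) (at t)"
    by (auto intro!: derivative_eq_intros simp: pos)
  also have "exp (- t) / (1 + exp (- t)) = sigmoid (- t)"
    using nz[of t] nz[of "- t"] by (simp add: sigmoid_def exp_minus field_simps)
  finally show ?thesis
    by (simp only: eq)
qed

lemma DERIV_pair_loss:
  "(pair_loss \<beta> w c has_real_derivative
     \<beta> * ((1 - c) * w * sigmoid (\<beta> * t) - c * sigmoid (- \<beta> * t))) (at t)"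
proof -
  have ln_sigmoid: "((\<lambda>t. ln (sigmoid (a * t))) has_real_derivative sigmoid (- (a * t)) * a) (at t)"
    for a :: real
    by (rule DERIV_chain2[OF DERIV_ln_sigmoid DERIV_cmult_Id])
  show ?thesis
    unfolding pair_loss_def
    by (rule derivative_eq_intros ln_sigmoid refl)+ (simp add: algebra_simps)
qed

lemma deriv_pair_loss_0: "deriv (pair_loss \<beta> w c) 0 = \<beta> / 2 * ((1 - c) * w - c)"
  using DERIV_imp_deriv[OF DERIV_pair_loss[of \<beta> w c 0]]
  by (simp add: sigmoid_def field_simps)

lemma GDERIV_pair_loss:
  assumes "D differentiable (at x)"
  shows "GDERIV (\<lambda>x. pair_loss \<beta> w c (D x)) x :> deriv (pair_loss \<beta> w c) (D x) *\<^sub>R grad D x"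
proof -
  have "DERIV (pair_loss \<beta> w c) (D x) :> deriv (pair_loss \<beta> w c) (D x)"
    using DERIV_pair_loss by (metis DERIV_imp_deriv)
  with GDERIV_grad[OF assms] show ?thesis
    by (rule GDERIV_DERIV_compose)
qed

text \<open>The chain rule for each pair. It turns the gradient of the actual loss into the form in
  which a decomposition of the margin can be substituted.\<close>

lemma expected_grad_eq_chain_grad:
  assumes "\<And>i. i \<in> {1..N} \<Longrightarrow> \<Delta> i differentiable (at \<theta>)"
  shows "expected_grad \<beta> w N c \<Delta> \<theta> = chain_grad \<beta> w N c \<Delta> \<Delta> \<theta>"
  using assms unfolding expected_grad_def chain_grad_def
  by (intro arg_cong[where f = "scaleR _"] sum.cong refl grad_eqI GDERIV_pair_loss)

text \<open>The scalar factors are evaluated at \<Delta> and do not change with the summands, so the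
  expression inherits additivity from the gradient. This separates the factual, style and error
  contributions.\<close>

lemma chain_grad_add:
  assumes "\<And>i. i \<in> {1..N} \<Longrightarrow> D i differentiable (at \<theta>)"
    and "\<And>i. i \<in> {1..N} \<Longrightarrow> E i differentiable (at \<theta>)"
  shows "chain_grad \<beta> w N c \<Delta> (\<lambda>i \<theta>. D i \<theta> + E i \<theta>) \<theta>
    = chain_grad \<beta> w N c \<Delta> D \<theta> + chain_grad \<beta> w N c \<Delta> E \<theta>"
proof -
  have "(\<Sum>i=1..N. deriv (pair_loss \<beta> w (c i)) (\<Delta> i \<theta>) *\<^sub>R grad (\<lambda>\<theta>. D i \<theta> + E i \<theta>) \<theta>)
    = (\<Sum>i=1..N. deriv (pair_loss \<beta> w (c i)) (\<Delta> i \<theta>) *\<^sub>R grad (D i) \<theta>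
        + deriv (pair_loss \<beta> w (c i)) (\<Delta> i \<theta>) *\<^sub>R grad (E i) \<theta>)"
    using assms by (intro sum.cong refl) (simp add: grad_add scaleR_add_right)
  then show ?thesis
    by (simp add: chain_grad_def sum.distrib scaleR_add_right)
qed

text \<open>Equality is required of whole functions, since a gradient is not determined by the value
  at \<theta>, but only at the indices that are summed.\<close>

lemma chain_grad_cong:
  assumes "\<And>i. i \<in> {1..N} \<Longrightarrow> D i = E i"
  shows "chain_grad \<beta> w N c \<Delta> D \<theta> = chain_grad \<beta> w N c \<Delta> E \<theta>"
  using assms unfolding chain_grad_def by (intro arg_cong[where f = "scaleR _"] sum.cong) auto

text \<open>At margin 0 the slope depends on the label alone, so the sum splits by label. The family
  \<open>D\<close> is arbitrary because the formula serves both the factual components and the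
  shared style component.\<close>

lemma chain_grad_zero_margin:
  assumes zero: "\<And>i. i \<in> {1..N} \<Longrightarrow> \<Delta> i \<theta> = 0"
    and label: "\<And>i. i \<in> {1..N} \<Longrightarrow> c i = 0 \<or> c i = 1"
  shows "chain_grad \<beta> w N c \<Delta> D \<theta> = (\<beta> / (2 * real N)) *\<^sub>R
    (- ((\<Sum>i | i \<in> {1..N} \<and> c i = 1. grad (D i) \<theta>)
        - w *\<^sub>R (\<Sum>i | i \<in> {1..N} \<and> c i = 0. grad (D i) \<theta>)))"
proof -
  \<comment> \<open>Writing the sums over one label as sums over all pairs puts both labels under a
    single sum, which can be compared term by term.\<close>
  have split: "(\<Sum>i | i \<in> {1..N} \<and> c i = a. g i) = (\<Sum>i=1..N. if c i = a then g i else 0)"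
    for a and g :: "nat \<Rightarrow> 'a"
    by (simp only: sum.inter_filter finite_atLeastAtMost)
  have "(\<Sum>i=1..N. deriv (pair_loss \<beta> w (c i)) (\<Delta> i \<theta>) *\<^sub>R grad (D i) \<theta>)
    = (\<Sum>i=1..N. (\<beta> / 2) *\<^sub>R (w *\<^sub>R (if c i = 0 then grad (D i) \<theta> else 0)
        - (if c i = 1 then grad (D i) \<theta> else 0)))"
    using label by (intro sum.cong refl) (fastforce simp: zero deriv_pair_loss_0)
  also have "\<dots> = (\<beta> / 2) *\<^sub>R (w *\<^sub>R (\<Sum>i | i \<in> {1..N} \<and> c i = 0. grad (D i) \<theta>)
      - (\<Sum>i | i \<in> {1..N} \<and> c i = 1. grad (D i) \<theta>))"
    by (simp only: split sum_subtractf scaleR_sum_right[symmetric])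
  finally show ?thesis
    by (simp add: chain_grad_def)
qed

lemma margin_eq_0: "\<pi> \<theta> = \<pi>ref \<Longrightarrow> margin \<pi> \<pi>ref q yw yl \<theta> = 0"
  by (simp add: margin_def)

text \<open>Positive probabilities keep the ratio away from the singularities of division and
  logarithm; the reference term is constant in \<theta>.\<close>

lemma differentiable_margin:
  assumes "pmf (\<pi> \<theta> q) yw > 0" and "pmf (\<pi> \<theta> q) yl > 0"
    and "(\<lambda>\<theta>. pmf (\<pi> \<theta> q) yw) differentiable (at \<theta>)"
    and "(\<lambda>\<theta>. pmf (\<pi> \<theta> q) yl) differentiable (at \<theta>)"
  shows "margin \<pi> \<pi>ref q yw yl differentiable (at \<theta>)"
proof -
  obtain Dw Dl where "((\<lambda>\<theta>. pmf (\<pi> \<theta> q) yw) has_derivative Dw) (at \<theta>)"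
    and "((\<lambda>\<theta>. pmf (\<pi> \<theta> q) yl) has_derivative Dl) (at \<theta>)"
    using assms(3,4) unfolding differentiable_def by blast
  note ratio = has_derivative_divide[OF this less_imp_neq[OF assms(2), symmetric]]
  have "(\<lambda>\<theta>. ln (pmf (\<pi> \<theta> q) yw / pmf (\<pi> \<theta> q) yl) - ln (pmf (\<pi>ref q) yw / pmf (\<pi>ref q) yl))
      differentiable (at \<theta>)"
    by (rule differentiableI
          [OF has_derivative_diff[OF has_derivative_ln[OF _ ratio] has_derivative_const]])
      (simp add: assms(1,2))
  then show ?thesis
    by (simp add: margin_def[abs_def])
qed

text \<open>The remainder \<open>err\<close> makes the approximate decomposition an exact identity.
  Substituting the approximation then means dropping the summand \<open>chain_grad\<close> of
  \<open>err\<close>, and the resulting gradient is given both before and after the style terms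
  cancel.\<close>

theorem proposition1:
  fixes \<pi> :: "'p::euclidean_space \<Rightarrow> 'q \<Rightarrow> 'y pmf"
    and \<pi>ref :: "'q \<Rightarrow> 'y pmf"
    and \<theta>ref :: 'p
    and N :: nat
    and q :: "nat \<Rightarrow> 'q"
    and yw yl :: "nat \<Rightarrow> 'y"
    and f c :: "nat \<Rightarrow> real"
    and \<beta> p w :: real
    and \<Delta> \<Delta>F err :: "nat \<Rightarrow> 'p \<Rightarrow> real"
    and \<Delta>S :: "'p \<Rightarrow> real"
  assumes init: "\<pi> \<theta>ref = \<pi>ref"
    and beta: "\<beta> > 0"
    and score: "\<And>i. i \<in> {1..N} \<Longrightarrow> 0 \<le> f i \<and> f i \<le> 1"
    and label: "\<And>i. i \<in> {1..N} \<Longrightarrow> c i = (if f i < 1/2 then 1 else 0)"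
    and share: "p = real (card {i \<in> {1..N}. c i = 1}) / real N"
    and p_range: "0 < p" "p < 1"
    and weight: "w = p / (1 - p)"
    and ref_pos: "\<And>i. i \<in> {1..N} \<Longrightarrow> pmf (\<pi>ref (q i)) (yw i) > 0 \<and> pmf (\<pi>ref (q i)) (yl i) > 0"
    and policy_diff:
      "\<And>i. i \<in> {1..N} \<Longrightarrow> (\<lambda>\<theta>. pmf (\<pi> \<theta> (q i)) (yw i)) differentiable (at \<theta>ref)"
      "\<And>i. i \<in> {1..N} \<Longrightarrow> (\<lambda>\<theta>. pmf (\<pi> \<theta> (q i)) (yl i)) differentiable (at \<theta>ref)"
    and margin: "\<And>i \<theta>. i \<in> {1..N} \<Longrightarrow> \<Delta> i \<theta> = margin \<pi> \<pi>ref (q i) (yw i) (yl i) \<theta>"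
    and decomposition: "\<And>i \<theta>. i \<in> {1..N} \<Longrightarrow> \<Delta> i \<theta> = \<Delta>F i \<theta> + \<Delta>S \<theta> + err i \<theta>"
    and factual_diff: "\<And>i. i \<in> {1..N} \<Longrightarrow> \<Delta>F i differentiable (at \<theta>ref)"
    and style_diff: "\<Delta>S differentiable (at \<theta>ref)"
  shows
    "(\<forall>i\<in>{1..N}. \<Delta> i \<theta>ref = 0 \<and>
       (\<lambda>\<theta>. pair_loss \<beta> w (c i) (\<Delta> i \<theta>)) differentiable (at \<theta>ref)) \<and>
     (expected_grad \<beta> w N c \<Delta> \<theta>ref = chain_grad \<beta> w N c \<Delta> \<Delta> \<theta>ref) \<and>
     (expected_grad \<beta> w N c \<Delta> \<theta>ref =
       chain_grad \<beta> w N c \<Delta> (\<lambda>i \<theta>. \<Delta>F i \<theta> + \<Delta>S \<theta>) \<theta>ref + chain_grad \<beta> w N c \<Delta> err \<theta>ref) \<and>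
     (chain_grad \<beta> w N c \<Delta> (\<lambda>i \<theta>. \<Delta>F i \<theta> + \<Delta>S \<theta>) \<theta>ref =
       (\<beta> / (2 * real N)) *\<^sub>R
         (- (((\<Sum>i | i \<in> {1..N} \<and> c i = 1. grad (\<Delta>F i) \<theta>ref)
              - w *\<^sub>R (\<Sum>i | i \<in> {1..N} \<and> c i = 0. grad (\<Delta>F i) \<theta>ref))
           + ((\<Sum>i | i \<in> {1..N} \<and> c i = 1. grad \<Delta>S \<theta>ref)
              - w *\<^sub>R (\<Sum>i | i \<in> {1..N} \<and> c i = 0. grad \<Delta>S \<theta>ref))))) \<and>
     ((\<Sum>i | i \<in> {1..N} \<and> c i = 1. grad \<Delta>S \<theta>ref) = (real N * p) *\<^sub>R grad \<Delta>S \<theta>ref) \<and>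
     (w *\<^sub>R (\<Sum>i | i \<in> {1..N} \<and> c i = 0. grad \<Delta>S \<theta>ref) = (w * (real N * (1 - p))) *\<^sub>R grad \<Delta>S \<theta>ref) \<and>
     (real N * p - w * (real N * (1 - p)) = 0) \<and>
     (0 < \<beta> / (2 * real N)) \<and>
     (chain_grad \<beta> w N c \<Delta> (\<lambda>i \<theta>. \<Delta>F i \<theta> + \<Delta>S \<theta>) \<theta>ref =
       (\<beta> / (2 * real N)) *\<^sub>R
         (- ((\<Sum>i | i \<in> {1..N} \<and> c i = 1. grad (\<Delta>F i) \<theta>ref)
             - w *\<^sub>R (\<Sum>i | i \<in> {1..N} \<and> c i = 0. grad (\<Delta>F i) \<theta>ref))))"
proof -
  let ?fact = "(\<Sum>i | i \<in> {1..N} \<and> c i = 1. grad (\<Delta>F i) \<theta>ref)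
    - w *\<^sub>R (\<Sum>i | i \<in> {1..N} \<and> c i = 0. grad (\<Delta>F i) \<theta>ref)"
  let ?style1 = "\<Sum>i | i \<in> {1..N} \<and> c i = 1. grad \<Delta>S \<theta>ref"
  let ?style0 = "\<Sum>i | i \<in> {1..N} \<and> c i = 0. grad \<Delta>S \<theta>ref"
  let ?FS = "\<lambda>i \<theta>. \<Delta>F i \<theta> + \<Delta>S \<theta>"
  \<comment> \<open>For \<open>N = 0\<close> the quotient defining \<open>p\<close> would be 0,
    against \<open>0 < p\<close>.\<close>
  have N: "real N > 0"
    using share p_range by (cases "N = 0") auto
  have label': "c i = 0 \<or> c i = 1" if "i \<in> {1..N}" for i
    using label[OF that] by simp
  have margin': "\<Delta> i = margin \<pi> \<pi>ref (q i) (yw i) (yl i)" if "i \<in> {1..N}" for i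
    using margin[OF that] by blast
  have zero: "\<Delta> i \<theta>ref = 0" if "i \<in> {1..N}" for i
    using margin[OF that] by (simp add: margin_eq_0 init)
  \<comment> \<open>Positivity is assumed of the reference policy and carries over because the two
    policies coincide at \<open>\<theta>ref\<close>.\<close>
  have diff: "\<Delta> i differentiable (at \<theta>ref)" if "i \<in> {1..N}" for i
    unfolding margin'[OF that]
    using ref_pos[OF that] policy_diff[OF that] by (intro differentiable_margin) (simp_all add: init)
  have FS_diff: "?FS i differentiable (at \<theta>ref)" if "i \<in> {1..N}" for i
    using factual_diff[OF that] style_diff by (rule differentiable_add)
  \<comment> \<open>As the difference of the margin and its two components, the remainder inherits
    their differentiability.\<close>
  have err_diff: "err i differentiable (at \<theta>ref)" if "i \<in> {1..N}" for i
  proof -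
    have "err i = (\<lambda>\<theta>. \<Delta> i \<theta> - ?FS i \<theta>)"
      using decomposition[OF that] by auto
    then show ?thesis
      using differentiable_diff[OF diff[OF that] FS_diff[OF that]] by simp
  qed
  have loss_diff: "(\<lambda>\<theta>. pair_loss \<beta> w (c i) (\<Delta> i \<theta>)) differentiable (at \<theta>ref)"
    if "i \<in> {1..N}" for i
    using GDERIV_pair_loss[OF diff[OF that]] unfolding gderiv_def differentiable_def by blast
  have exp_chain: "expected_grad \<beta> w N c \<Delta> \<theta>ref = chain_grad \<beta> w N c \<Delta> \<Delta> \<theta>ref"
    using diff by (rule expected_grad_eq_chain_grad)
  have "chain_grad \<beta> w N c \<Delta> \<Delta> \<theta>ref
      = chain_grad \<beta> w N c \<Delta> (\<lambda>i \<theta>. ?FS i \<theta> + err i \<theta>) \<theta>ref"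
    using decomposition by (intro chain_grad_cong) auto
  also have "\<dots> = chain_grad \<beta> w N c \<Delta> ?FS \<theta>ref + chain_grad \<beta> w N c \<Delta> err \<theta>ref"
    using FS_diff err_diff by (rule chain_grad_add)
  finally have exp_split: "expected_grad \<beta> w N c \<Delta> \<theta>ref
      = chain_grad \<beta> w N c \<Delta> ?FS \<theta>ref + chain_grad \<beta> w N c \<Delta> err \<theta>ref"
    using exp_chain by simp
  \<comment> \<open>Assumption A2 enters here: the style component is a family constant in the
    index.\<close>
  have "chain_grad \<beta> w N c \<Delta> ?FS \<theta>ref
      = chain_grad \<beta> w N c \<Delta> \<Delta>F \<theta>ref + chain_grad \<beta> w N c \<Delta> (\<lambda>_. \<Delta>S) \<theta>ref"
    using factual_diff style_diff by (intro chain_grad_add)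
  also have "\<dots> = (\<beta> / (2 * real N)) *\<^sub>R (- ?fact)
      + (\<beta> / (2 * real N)) *\<^sub>R (- (?style1 - w *\<^sub>R ?style0))"
    by (simp only: chain_grad_zero_margin[of N \<Delta> \<theta>ref c, OF zero label'])
  finally have FS: "chain_grad \<beta> w N c \<Delta> ?FS \<theta>ref
      = (\<beta> / (2 * real N)) *\<^sub>R (- (?fact + (?style1 - w *\<^sub>R ?style0)))"
    by (simp only: minus_add_distrib scaleR_add_right)
  have card1: "real (card {i. i \<in> {1..N} \<and> c i = 1}) = real N * p"
    using share N by simp
  \<comment> \<open>The two labels partition the pairs, so the number of pairs with label 0 is the
    complement of \<open>real N * p\<close>.\<close>
  have "card {1..N} = card ({i. i \<in> {1..N} \<and> c i = 1} \<union> {i. i \<in> {1..N} \<and> c i = 0})"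
    using label' by (intro arg_cong[where f = card]) blast
  also have "\<dots> = card {i. i \<in> {1..N} \<and> c i = 1} + card {i. i \<in> {1..N} \<and> c i = 0}"
    by (intro card_Un_disjoint) auto
  finally have card0: "real (card {i. i \<in> {1..N} \<and> c i = 0}) = real N * (1 - p)"
    using card1 by (simp add: algebra_simps flip: of_nat_add)
  have style1: "?style1 = (real N * p) *\<^sub>R grad \<Delta>S \<theta>ref"
    by (simp only: sum_constant_scaleR card1)
  have style0: "w *\<^sub>R ?style0 = (w * (real N * (1 - p))) *\<^sub>R grad \<Delta>S \<theta>ref"
    by (simp only: sum_constant_scaleR card0 scaleR_scaleR)
  \<comment> \<open>Since \<open>p < 1\<close>, the definition of \<open>w\<close> gives
    \<open>w * (1 - p) = p\<close>.\<close>
  have balance: "real N * p - w * (real N * (1 - p)) = 0"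
    using weight p_range by simp
  have "?style1 - w *\<^sub>R ?style0 = 0"
    unfolding style1 style0 scaleR_left_diff_distrib[symmetric] balance by simp
  with FS have FS': "chain_grad \<beta> w N c \<Delta> ?FS \<theta>ref = (\<beta> / (2 * real N)) *\<^sub>R (- ?fact)"
    by simp
  show ?thesis
    using zero loss_diff exp_chain exp_split FS style1 style0 balance beta N FS'
    by (intro conjI ballI) (assumption | simp)+
qed

end
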